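(* Let $p$ be a prime and let $\mathcal{X}=(\Omega,S)$ be a $\{1,p\}$-scheme whose thin residue is isomorphic to an elementary abelian $p$-group of rank greater than two. Then $\mathcal{X}$ is schurian and separable.
   Context: An association scheme on a finite set $\Omega$ is a pair $\mathcal{X}=(\Omega,S)$ where $S$ is a partition of $\Omega\times\Omega$ such that the diagonal $1_\Omega\in S$, $S^*=S$ (where $r^*=\{(\beta,\alpha):(\alpha,\beta)\in r\}$), and for all $r,s,t\in S$ the number $c_{rs}^t=|\alpha r\cap\beta s^*|$ does not depend on $(\alpha,\beta)\in t$; here $\alpha r=\{\beta:(\alpha,\beta)\in r\}$. The valency of $s\in S$ is $n_s=|\alpha s|$; $s$ is thin if $n_s=1$. A $\{1,p\}$-scheme is one in which every basis relation has valency $1$ or $p$, both occurring. For $r,s\in S$ the complex product $rs$ is the set of basis relations contained in the composition $r\cdot s$. The thin residue of $\mathcal{X}$ is the smallest subset of $S$ containing all elements of $ss^*$ for $s\in S$ and closed under complex products; the hypothesis means that it consists of thin relations, which form a group under composition isomorphic to an elementary abelian group $E_{p^m}$ with $m\ge3$. A scheme is schurian if there is a transitive permutation group $K\le\mathrm{Sym}(\Omega)$ whose orbits on $\Omega\times\Omega$ are exactly the elements of $S$. An algebraic isomorphism from $\mathcal{X}$ to a scheme $\mathcal{X}'=(\Omega',S')$ is a bijection $\varphi:S\to S'$ with $c_{rs}^t=c_{r^\varphi s^\varphi}^{t^\varphi}$ for all $r,s,t\in S$; $\mathcal{X}$ is separable if for every such $\varphi$ there exists a bijection $f:\Omega\to\Omega'$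 with $r^f=r^\varphi$ for all $r\in S$. *)

theory Defs
  imports
    "HOL-Library.Disjoint_Sets"
    "HOL-Computational_Algebra.Primes"
    "HOL-Algebra.Group_Action"
    "HOL-Algebra.Elementary_Groups"
    "HOL-Algebra.Product_Groups"
begin

locale association_scheme =
  fixes \<Omega> :: "'a set" and S :: "'a rel set"
  assumes finite_points: "finite \<Omega>"
    and partition: "partition_on (\<Omega> \<times> \<Omega>) S"
    and diagonal: "Id_on \<Omega> \<in> S"
    and converse_closed: "converse ` S = S"
    and intersection_regular:
      "\<lbrakk>r \<in> S; s \<in> S; t \<in> S\<rbrakk> \<Longrightarrow>
        \<exists>n. \<forall>(\<alpha>, \<beta>) \<in> t. card (r `` {\<alpha>} \<inter> (s\<inverse>) `` {\<beta>}) = n"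

text \<open>The two definite descriptions below are justified for association schemes by the
  lemmas \<open>card_eq_intersection_number\<close> and \<open>card_eq_valency\<close>.\<close>

definition intersection_number :: "'a rel \<Rightarrow> 'a rel \<Rightarrow> 'a rel \<Rightarrow> nat" where
  "intersection_number r s t =
     (THE n. \<forall>(\<alpha>, \<beta>) \<in> t. card (r `` {\<alpha>} \<inter> (s\<inverse>) `` {\<beta>}) = n)"

definition valency :: "'a set \<Rightarrow> 'a rel \<Rightarrow> nat" where
  "valency \<Omega> s = (THE n. \<forall>\<alpha> \<in> \<Omega>. card (s `` {\<alpha>}) = n)"

definition thin :: "'a set \<Rightarrow> 'a rel \<Rightarrow> bool" where
  "thin \<Omega> s \<longleftrightarrow> valency \<Omega> s = 1"

definition one_p_scheme :: "nat \<Rightarrow> 'a set \<Rightarrow> 'a rel set \<Rightarrow> bool" where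
  "one_p_scheme p \<Omega> S \<longleftrightarrow> association_scheme \<Omega> S \<and> valency \<Omega> ` S = {1, p}"

definition complex_product :: "'a rel set \<Rightarrow> 'a rel \<Rightarrow> 'a rel \<Rightarrow> 'a rel set" where
  "complex_product S r s = {t \<in> S. t \<subseteq> r O s}"

definition thin_residue :: "'a rel set \<Rightarrow> 'a rel set" where
  "thin_residue S = \<Inter>{T. T \<subseteq> S \<and> (\<forall>s \<in> S. complex_product S s (s\<inverse>) \<subseteq> T)
     \<and> (\<forall>r \<in> T. \<forall>s \<in> T. complex_product S r s \<subseteq> T)}"

text \<open>This is a group when all relations in the thin residue are thin.\<close>

definition thin_residue_group :: "'a set \<Rightarrow> 'a rel set \<Rightarrow> 'a rel monoid" where
  "thin_residue_group \<Omega> S = \<lparr>carrier = thin_residue S, mult = (O), one = Id_on \<Omega>\<rparr>"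

text \<open>The elementary abelian group of order \<open>p ^ m\<close> and rank \<open>m\<close>, for \<open>p\<close> prime.\<close>

definition elementary_abelian :: "nat \<Rightarrow> nat \<Rightarrow> (nat \<Rightarrow> int) monoid" where
  "elementary_abelian p m = product_group {..<m} (\<lambda>_. integer_mod_group p)"

definition schurian :: "'a set \<Rightarrow> 'a rel set \<Rightarrow> bool" where
  "schurian \<Omega> S \<longleftrightarrow> (\<exists>K. subgroup K (BijGroup \<Omega>)
     \<and> transitive_action ((BijGroup \<Omega>)\<lparr>carrier := K\<rparr>) \<Omega> (\<lambda>g. g)
     \<and> orbits ((BijGroup \<Omega>)\<lparr>carrier := K\<rparr>) (\<Omega> \<times> \<Omega>) (\<lambda>g. map_prod g g) = S)"

definition algebraic_isomorphism ::
    "'a rel set \<Rightarrow> 'b rel set \<Rightarrow> ('a rel \<Rightarrow> 'b rel) \<Rightarrow> bool" where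
  "algebraic_isomorphism S S' \<phi> \<longleftrightarrow> bij_betw \<phi> S S' \<and>
     (\<forall>r \<in> S. \<forall>s \<in> S. \<forall>t \<in> S.
        intersection_number r s t = intersection_number (\<phi> r) (\<phi> s) (\<phi> t))"

text \<open>A formula of HOL cannot quantify over types, so the type \<open>'b\<close> of the points of the second
  scheme is a parameter. Leaving \<open>'b\<close> free in a theorem makes it range over all types.\<close>

definition separable :: "'b itself \<Rightarrow> 'a set \<Rightarrow> 'a rel set \<Rightarrow> bool" where
  "separable (_ :: 'b itself) \<Omega> S \<longleftrightarrow>
     (\<forall>(\<Omega>' :: 'b set) S' \<phi>. association_scheme \<Omega>' S' \<and> algebraic_isomorphism S S' \<phi> \<longrightarrow>
        (\<exists>f. bij_betw f \<Omega> \<Omega>' \<and> (\<forall>r \<in> S. map_prod f f ` r = \<phi> r)))"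

context association_scheme
begin

lemma points_nonempty: "\<Omega> \<noteq> {}"
  using partition diagonal by (auto simp: partition_on_def)

lemma card_eq_intersection_number:
  assumes "r \<in> S" "s \<in> S" "t \<in> S" "(\<alpha>, \<beta>) \<in> t"
  shows "card (r `` {\<alpha>} \<inter> (s\<inverse>) `` {\<beta>}) = intersection_number r s t"
proof -
  obtain n where n: "\<forall>(\<alpha>, \<beta>) \<in> t. card (r `` {\<alpha>} \<inter> (s\<inverse>) `` {\<beta>}) = n"
    using intersection_regular assms by blast
  then have "intersection_number r s t = n"
    unfolding intersection_number_def using assms(4) by (intro the_equality) auto
  then show ?thesis using n assms(4) by auto
qed

lemma card_eq_valency:
  assumes "s \<in> S" "\<alpha> \<in> \<Omega>"
  shows "card (s `` {\<alpha>}) = valency \<Omega> s"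
proof -
  have "s\<inverse> \<in> S" using converse_closed assms(1) by blast
  then have c: "card (s `` {\<beta>}) = intersection_number s (s\<inverse>) (Id_on \<Omega>)" if "\<beta> \<in> \<Omega>" for \<beta>
    using card_eq_intersection_number[OF assms(1) _ diagonal, of "s\<inverse>" \<beta> \<beta>] that by auto
  then have "valency \<Omega> s = intersection_number s (s\<inverse>) (Id_on \<Omega>)"
    unfolding valency_def using assms(2) by (intro the_equality) auto
  then show ?thesis using c assms(2) by simp
qed

end

end

theory Submission
  imports Defs
begin

text \<open>Every basis relation \<open>s\<close> determines the subgroup \<open>s s\<^sup>*\<close> of the thin residue \<open>T\<close>,
  which is its stabilizer under left multiplication and has order 1 or \<open>p\<close>. Seen from a base
  point \<open>\<alpha>\<close>, the points thus become lines \<open>L x\<close> (or the trivial group) in \<open>T\<close>. These lines generate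
  \<open>T\<close>, and since \<open>T\<close> has order greater than \<open>p\<^sup>2\<close>, no plane \<open>L x L y\<close> contains them all. If \<open>L g\<close>
  is not contained in the plane \<open>L h L k\<close>, the relation between \<open>h\<close> and \<open>k\<close> is the only one in the
  intersection of the complex products along the paths from \<open>h\<close> to \<open>k\<close> through \<open>\<alpha>\<close> and through \<open>g\<close>.
  Hence, given an algebraic isomorphism \<open>\<phi>\<close> and prescribed images of \<open>\<alpha>\<close> and of one point \<open>g\<close> with
  \<open>L g\<close> nontrivial, the images of all other points can be chosen one at a time and still match \<open>\<phi>\<close>
  on every pair. The resulting two-point extension property yields separability and, for the
  identity \<open>\<phi>\<close>, schurity.\<close>

section \<open>Subgroups of prime order\<close>

text \<open>By Lagrange in \<open>P\<close>, the intersection has order 1 or that of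
  \<open>P\<close>; the latter would put \<open>P\<close> inside \<open>A\<close>.\<close>

lemma (in group) prime_order_Int_trivial:
  assumes P: "subgroup P G" and A: "subgroup A G"
    and card: "card P = 1 \<or> prime (card P)" and "\<not> P \<subseteq> A"
  shows "P \<inter> A = {\<one>}"
proof -
  have sub: "subgroup (P \<inter> A) G"
    using P A by (rule subgroups_Inter_pair)
  have fin: "finite P"
    using card prime_gt_0_nat card_gt_0_iff by (metis zero_less_one)
  interpret P: group "G\<lparr>carrier := P\<rparr>"
    using P by (rule subgroup_imp_group)
  have "subgroup (P \<inter> A) (G\<lparr>carrier := P\<rparr>)"
    using subgroup_incl[OF sub P] by simp
  from P.lagrange[OF this] have "card (P \<inter> A) dvd card P"
    by (simp add: order_def) (metis dvd_triv_right)
  moreover have "card (P \<inter> A) \<noteq> card P"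
    using fin \<open>\<not> P \<subseteq> A\<close> by (metis card_subset_eq inf.orderI inf_le1)
  ultimately have "card (P \<inter> A) = 1"
    using card by (auto simp: prime_nat_iff)
  moreover have "\<one> \<in> P \<inter> A"
    using sub by (rule subgroup.one_closed)
  ultimately show ?thesis
    by (metis card_1_singletonE singletonD)
qed

lemma (in comm_group) set_mult_commute_subsets:
  assumes "A \<subseteq> carrier G" "B \<subseteq> carrier G"
  shows "A <#> B = B <#> A"
proof -
  have "C <#> D \<subseteq> D <#> C" if "C \<subseteq> carrier G" "D \<subseteq> carrier G" for C D
  proof
    fix x assume "x \<in> C <#> D"
    then obtain c d where cd: "c \<in> C" "d \<in> D" "x = c \<otimes> d" unfolding set_mult_def by blast
    then have "x = d \<otimes> c" using m_comm that by blast
    then show "x \<in> D <#> C" using cd unfolding set_mult_def by blast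
  qed
  then show ?thesis using assms by blast
qed

text \<open>An element \<open>b \<otimes> c\<close> of \<open>P\<close> outside \<open>A\<close> has
  a nontrivial \<open>Q\<close>-part \<open>c\<close>, which lies in \<open>A <#> P\<close>; so
  \<open>Q\<close>, of prime order, lies there entirely.\<close>

lemma (in comm_group) prime_order_exchange:
  assumes A: "subgroup A G" and P: "subgroup P G" and Q: "subgroup Q G"
    and card: "card Q = 1 \<or> prime (card Q)"
    and "\<not> P \<subseteq> A" "P \<subseteq> A <#> Q"
  shows "Q \<subseteq> A <#> P"
proof (rule ccontr)
  assume "\<not> Q \<subseteq> A <#> P"
  then have triv: "Q \<inter> (A <#> P) = {\<one>}"
    using prime_order_Int_trivial[OF Q mult_subgroups[OF A P] card] by simp
  obtain a where a: "a \<in> P" "a \<notin> A" using \<open>\<not> P \<subseteq> A\<close> by blast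
  then obtain b c where bc: "b \<in> A" "c \<in> Q" "a = b \<otimes> c"
    using \<open>P \<subseteq> A <#> Q\<close> unfolding set_mult_def by blast
  have cl: "a \<in> carrier G" "b \<in> carrier G" "c \<in> carrier G"
    using a bc A P Q subgroup.mem_carrier by metis+
  have "c = inv b \<otimes> a"
    using cl bc inv_solve_left by simp
  then have "c \<in> A <#> P"
    using a bc subgroup.m_inv_closed[OF A] unfolding set_mult_def by blast
  then have "c = \<one>" using triv bc by blast
  then show False using a bc cl by simp
qed

section \<open>Basis relations as functions of pairs of points\<close>

context association_scheme
begin

definition rel :: "'a \<Rightarrow> 'a \<Rightarrow> 'a rel" where
  "rel x y = (THE s. s \<in> S \<and> (x, y) \<in> s)"

lemma basis_subset: "s \<in> S \<Longrightarrow> s \<subseteq> \<Omega> \<times> \<Omega>"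
  using partition by (auto simp: partition_on_def)

lemma basis_points: "s \<in> S \<Longrightarrow> (x, y) \<in> s \<Longrightarrow> x \<in> \<Omega> \<and> y \<in> \<Omega>"
  using basis_subset by blast

lemma basis_nonempty: "s \<in> S \<Longrightarrow> \<exists>x y. (x, y) \<in> s"
  using partition by (metis partition_on_def ex_in_conv surj_pair)

lemma basis_eqI: "r \<in> S \<Longrightarrow> s \<in> S \<Longrightarrow> (x, y) \<in> r \<Longrightarrow> (x, y) \<in> s \<Longrightarrow> r = s"
  using partition unfolding partition_on_def disjoint_def by blast

lemma rel_eqI: "s \<in> S \<Longrightarrow> (x, y) \<in> s \<Longrightarrow> rel x y = s"
  unfolding rel_def using basis_eqI by (intro the_equality) auto

lemma ex_basis: "x \<in> \<Omega> \<Longrightarrow> y \<in> \<Omega> \<Longrightarrow> \<exists>s\<in>S. (x, y) \<in> s"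
  using partition unfolding partition_on_def by (metis SigmaI UnionE)

lemma rel_basis [simp]: "x \<in> \<Omega> \<Longrightarrow> y \<in> \<Omega> \<Longrightarrow> rel x y \<in> S"
  using ex_basis rel_eqI by metis

lemma in_rel [simp]: "x \<in> \<Omega> \<Longrightarrow> y \<in> \<Omega> \<Longrightarrow> (x, y) \<in> rel x y"
  using ex_basis rel_eqI by metis

lemma converse_basis [simp]: "s \<in> S \<Longrightarrow> s\<inverse> \<in> S"
  using converse_closed by blast

lemma rel_converse: "x \<in> \<Omega> \<Longrightarrow> y \<in> \<Omega> \<Longrightarrow> (rel x y)\<inverse> = rel y x"
  by (rule rel_eqI[symmetric]) auto

lemma finite_basis: "s \<in> S \<Longrightarrow> finite s"
  using basis_subset finite_points by (meson finite_SigmaI finite_subset)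

lemma finite_scheme: "finite S"
  using basis_subset finite_points
  by (intro finite_subset[of S "Pow (\<Omega> \<times> \<Omega>)"]) auto

text \<open>The intersection number counts the middle points between \<open>x\<close> and
  \<open>z\<close>. As it is constant on \<open>t\<close>, one pair of \<open>t\<close> in
  \<open>r O s\<close> brings in the whole of \<open>t\<close>.\<close>

lemma subset_relcomp_iff:
  assumes "r \<in> S" "s \<in> S" "t \<in> S" "(x, z) \<in> t"
  shows "(x, z) \<in> r O s \<longleftrightarrow> intersection_number r s t \<noteq> 0"
proof -
  have "finite (r `` {x} \<inter> (s\<inverse>) `` {z})"
    using finite_basis[OF assms(1)] by (simp add: finite_Image)
  then have "intersection_number r s t \<noteq> 0 \<longleftrightarrow> r `` {x} \<inter> (s\<inverse>) `` {z} \<noteq> {}"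
    using card_eq_intersection_number[OF assms] by (metis card_eq_0_iff)
  then show ?thesis by blast
qed

lemma complex_product_iff:
  assumes "r \<in> S" "s \<in> S" "t \<in> S"
  shows "t \<subseteq> r O s \<longleftrightarrow> intersection_number r s t \<noteq> 0"
proof
  assume sub: "t \<subseteq> r O s"
  obtain x z where "(x, z) \<in> t" using basis_nonempty assms(3) by blast
  then show "intersection_number r s t \<noteq> 0"
    using subset_relcomp_iff[OF assms] sub by blast
next
  assume "intersection_number r s t \<noteq> 0"
  then show "t \<subseteq> r O s"
    using subset_relcomp_iff[OF assms] by auto
qed

lemma subset_relcompI:
  assumes "r \<in> S" "s \<in> S" "t \<in> S" "(x, z) \<in> t" "(x, z) \<in> r O s"
  shows "t \<subseteq> r O s"
  using complex_product_iff[OF assms(1-3)] subset_relcomp_iff[OF assms(1-4)] assms(5) by simp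

lemma rel_subset_relcomp:
  assumes "r \<in> S" "s \<in> S" "(x, y) \<in> r" "(y, z) \<in> s"
  shows "rel x z \<subseteq> r O s"
proof (rule subset_relcompI)
  show "(x, z) \<in> r O s" using assms(3,4) by (rule relcompI)
qed (use assms basis_points in auto)

lemma rel_triangle: "x \<in> \<Omega> \<Longrightarrow> y \<in> \<Omega> \<Longrightarrow> z \<in> \<Omega> \<Longrightarrow> rel x z \<subseteq> rel x y O rel y z"
  by (rule rel_subset_relcomp[of _ _ x y]) auto

text \<open>One pair of \<open>s\<close> puts one diagonal pair, hence the whole diagonal, into
  \<open>s O s\<inverse>\<close>.\<close>

lemma basis_Image_nonempty:
  assumes "s \<in> S" "x \<in> \<Omega>"
  shows "\<exists>y. (x, y) \<in> s"
proof -
  have "Id_on \<Omega> \<subseteq> s O s\<inverse>"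
    using basis_nonempty[OF assms(1)] basis_points[OF assms(1)] diagonal assms(1)
    by (metis Id_onI converse_basis converseI relcompI subset_relcompI)
  then show ?thesis using assms(2) by blast
qed

text \<open>Double counting of the pairs in \<open>s\<close> and in its converse.\<close>

lemma valency_converse:
  assumes "s \<in> S"
  shows "valency \<Omega> (s\<inverse>) = valency \<Omega> s"
proof -
  have card: "card r = card \<Omega> * valency \<Omega> r" if "r \<in> S" for r
  proof -
    have "r = (SIGMA x:\<Omega>. r `` {x})"
      using basis_subset[OF that] by auto
    then have "card r = (\<Sum>x\<in>\<Omega>. card (r `` {x}))"
      using card_SigmaI[OF finite_points, of "\<lambda>x. r `` {x}"] finite_basis[OF that]
      by (metis finite_Image)
    then show ?thesis using card_eq_valency[OF that] by simp
  qed
  have "card \<Omega> \<noteq> 0" using finite_points points_nonempty by simp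
  then show ?thesis
    using card[OF assms] card[of "s\<inverse>"] assms by (simp add: card_inverse)
qed

section \<open>Composition with thin relations\<close>

lemma valency_1_unique:
  assumes "t \<in> S" "valency \<Omega> t = 1" "(x, y) \<in> t" "(x, z) \<in> t"
  shows "y = z"
proof -
  have "card (t `` {x}) = 1"
    using card_eq_valency assms basis_points by metis
  then obtain w where w: "t `` {x} = {w}" by (metis card_1_singletonE)
  have "y \<in> t `` {x}" "z \<in> t `` {x}" using assms by auto
  then show ?thesis using w by simp
qed

lemma valency_1_unique_left:
  assumes "t \<in> S" "valency \<Omega> t = 1" "(y, x) \<in> t" "(z, x) \<in> t"
  shows "y = z"
  using valency_1_unique[of "t\<inverse>" x y z] assms by (simp add: valency_converse)

text \<open>The relation of the end points of one path lies in \<open>t O u\<close>. Conversely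
  \<open>u\<close> lies in \<open>t\<inverse>\<close> composed with that relation, and predecessors
  under \<open>t\<close> are unique.\<close>

lemma thin_relcomp_basis:
  assumes t: "t \<in> S" "valency \<Omega> t = 1" and u: "u \<in> S"
  shows "t O u \<in> S"
proof -
  obtain x y where xy: "(x, y) \<in> t" using basis_nonempty t by blast
  then obtain z where yz: "(y, z) \<in> u"
    using basis_Image_nonempty u basis_points t by blast
  have pts: "x \<in> \<Omega>" "y \<in> \<Omega>" "z \<in> \<Omega>" using xy yz basis_points t u by blast+
  let ?w = "rel x z"
  have w: "?w \<in> S" "(x, z) \<in> ?w" using pts by auto
  have "?w \<subseteq> t O u"
    using subset_relcompI[OF t(1) u w] xy yz by blast
  moreover have "u \<subseteq> t\<inverse> O ?w"
    using subset_relcompI[of "t\<inverse>" ?w u y z] xy yz w t u by auto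
  then have "t O u \<subseteq> ?w"
    using valency_1_unique_left[OF t] by blast
  ultimately show ?thesis using w by simp
qed

lemma thin_relcomp_eqI:
  assumes "t \<in> S" "valency \<Omega> t = 1" "u \<in> S" "v \<in> S" "(x, y) \<in> t" "(y, z) \<in> u" "(x, z) \<in> v"
  shows "t O u = v"
proof (rule basis_eqI)
  show "(x, z) \<in> t O u" using assms(5,6) by (rule relcompI)
qed (use assms thin_relcomp_basis in auto)

lemma Id_on_relcomp [simp]: "s \<in> S \<Longrightarrow> Id_on \<Omega> O s = s" "s \<in> S \<Longrightarrow> s O Id_on \<Omega> = s"
  using basis_points by fastforce+

lemma thin_converse_relcomp:
  assumes "t \<in> S" "valency \<Omega> t = 1"
  shows "t\<inverse> O t = Id_on \<Omega>"
proof -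
  obtain x y where "(x, y) \<in> t" using basis_nonempty assms by blast
  then show ?thesis
    using thin_relcomp_eqI[of "t\<inverse>" t "Id_on \<Omega>" y x y] assms diagonal basis_points
    by (auto simp: valency_converse)
qed

lemma sum_valency:
  "(\<Sum>s\<in>S. valency \<Omega> s) = card \<Omega>"
proof -
  obtain x where x: "x \<in> \<Omega>" using points_nonempty by blast
  have "\<Omega> = (\<Union>s\<in>S. s `` {x})"
    using x ex_basis basis_points by fastforce
  moreover have "card (\<Union>s\<in>S. s `` {x}) = (\<Sum>s\<in>S. card (s `` {x}))"
    using finite_scheme finite_basis by (intro card_UN_disjoint) (auto simp: finite_Image dest: basis_eqI)
  ultimately show ?thesis using card_eq_valency x by simp
qed

section \<open>The thin residue\<close>

lemma complex_product_converse_residue: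
  "s \<in> S \<Longrightarrow> complex_product S s (s\<inverse>) \<subseteq> thin_residue S"
  unfolding thin_residue_def by blast

lemma thin_residue_subset: "thin_residue S \<subseteq> S"
  unfolding thin_residue_def complex_product_def by blast

lemma thin_residue_complex_product:
  "r \<in> thin_residue S \<Longrightarrow> s \<in> thin_residue S \<Longrightarrow> complex_product S r s \<subseteq> thin_residue S"
  unfolding thin_residue_def by blast

lemma thin_residue_least:
  assumes "T \<subseteq> S" "\<And>s. s \<in> S \<Longrightarrow> complex_product S s (s\<inverse>) \<subseteq> T"
    "\<And>r s. r \<in> T \<Longrightarrow> s \<in> T \<Longrightarrow> complex_product S r s \<subseteq> T"
  shows "thin_residue S \<subseteq> T"
  unfolding thin_residue_def by (intro Inter_lower CollectI conjI ballI assms)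

lemma Id_in_thin_residue: "Id_on \<Omega> \<in> thin_residue S"
  using complex_product_converse_residue[OF diagonal] diagonal
  unfolding complex_product_def by auto

text \<open>The composition of two thin relations is itself a member of their complex product, which
  gives closure. Inverses come later, by transport along the isomorphism with the elementary abelian
  group.\<close>

lemma monoid_thin_residue_group:
  assumes thin: "\<forall>s \<in> thin_residue S. valency \<Omega> s = 1"
  shows "monoid (thin_residue_group \<Omega> S)"
proof (rule monoidI; unfold thin_residue_group_def; simp)
  show "r O s \<in> thin_residue S" if "r \<in> thin_residue S" "s \<in> thin_residue S" for r s
    using thin_residue_complex_product[OF that] thin_relcomp_basis[of r s] that thin thin_residue_subset
    unfolding complex_product_def by auto
qed (use Id_in_thin_residue thin_residue_subset Id_on_relcomp in \<open>auto simp: O_assoc\<close>)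

end

section \<open>Schemes with abelian thin residue\<close>

lemma thin_residue_group_simps [simp]:
  "carrier (thin_residue_group \<Omega> S) = thin_residue S"
  "mult (thin_residue_group \<Omega> S) = (O)"
  "one (thin_residue_group \<Omega> S) = Id_on \<Omega>"
  by (simp_all add: thin_residue_group_def)

text \<open>Commutativity makes products of stabilizers subgroups; the bound \<open>p ^ 2\<close>
  keeps a product of two of them from being the whole residue.\<close>

locale abelian_residue_scheme = association_scheme +
  fixes p :: nat
  assumes prime_p: "prime p"
    and valencies: "valency \<Omega> ` S = {1, p}"
    and residue_thin: "s \<in> thin_residue S \<Longrightarrow> valency \<Omega> s = 1"
    and comm_group_residue: "comm_group (thin_residue_group \<Omega> S)"
    and card_residue: "p ^ 2 < card (thin_residue S)"
begin

sublocale residue: comm_group "thin_residue_group \<Omega> S"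
  by (rule comm_group_residue)

lemma valency_cases: "s \<in> S \<Longrightarrow> valency \<Omega> s = 1 \<or> valency \<Omega> s = p"
  using valencies by blast

section \<open>Stabilizers of basis relations in the thin residue\<close>

abbreviation left_stab :: "'a rel \<Rightarrow> 'a rel set" where
  "left_stab s \<equiv> complex_product S s (s\<inverse>)"

abbreviation stab_prod :: "'a rel \<Rightarrow> 'a rel \<Rightarrow> 'a rel set" where
  "stab_prod r s \<equiv> left_stab r <#>\<^bsub>thin_residue_group \<Omega> S\<^esub> left_stab s"

lemma left_stab_residue: "s \<in> S \<Longrightarrow> t \<in> left_stab s \<Longrightarrow> t \<in> thin_residue S"
  using complex_product_converse_residue by blast

lemma residue_basis: "t \<in> thin_residue S \<Longrightarrow> t \<in> S"
  using thin_residue_subset by blast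

lemma left_stab_basis: "s \<in> S \<Longrightarrow> t \<in> left_stab s \<Longrightarrow> t \<in> S"
  by (simp add: complex_product_def)

lemma left_stab_valency: "s \<in> S \<Longrightarrow> t \<in> left_stab s \<Longrightarrow> valency \<Omega> t = 1"
  using left_stab_residue residue_thin by simp

lemma left_stab_rel:
  assumes "s \<in> S" "(x, y) \<in> s" "(z, y) \<in> s"
  shows "rel x z \<in> left_stab s"
proof -
  have "x \<in> \<Omega>" "z \<in> \<Omega>" using assms basis_points by blast+
  then have "rel x z \<subseteq> s O s\<inverse>"
    using subset_relcompI[of s "s\<inverse>" "rel x z" x z] assms by auto
  then show ?thesis
    using \<open>x \<in> \<Omega>\<close> \<open>z \<in> \<Omega>\<close> by (simp add: complex_product_def)
qed

lemma left_stab_relcomp: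
  assumes "s \<in> S" "t \<in> left_stab s"
  shows "t O s = s"
proof -
  have t: "t \<in> S" "valency \<Omega> t = 1"
    using assms left_stab_residue residue_basis residue_thin by blast+
  obtain x z where xz: "(x, z) \<in> t" using basis_nonempty t by blast
  moreover have "t \<subseteq> s O s\<inverse>" using assms by (simp add: complex_product_def)
  ultimately obtain y where "(x, y) \<in> s" "(z, y) \<in> s" by blast
  then show ?thesis using thin_relcomp_eqI[OF t assms(1) assms(1) xz] by blast
qed

lemma left_stabI:
  assumes s: "s \<in> S" and t: "t \<in> S" and fixed: "t O s = s"
  shows "t \<in> left_stab s"
proof -
  have "t \<subseteq> s O s\<inverse>"
  proof (rule subrelI)
    fix x z assume xz: "(x, z) \<in> t"
    then obtain y where y: "(z, y) \<in> s"
      using basis_Image_nonempty[OF s] basis_points[OF t] by blast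
    then have "(x, y) \<in> s" using xz fixed by blast
    then show "(x, z) \<in> s O s\<inverse>" using y by blast
  qed
  then show ?thesis using t by (simp add: complex_product_def)
qed

lemma subgroup_left_stab:
  assumes "s \<in> S"
  shows "subgroup (left_stab s) (thin_residue_group \<Omega> S)"
proof (rule residue.subgroupI)
  show "left_stab s \<subseteq> carrier (thin_residue_group \<Omega> S)"
    using left_stab_residue assms by auto
  show "left_stab s \<noteq> {}"
    using left_stabI[OF assms diagonal] assms by auto
next
  fix t assume t: "t \<in> left_stab s"
  let ?u = "inv\<^bsub>thin_residue_group \<Omega> S\<^esub> t"
  have tc: "t \<in> carrier (thin_residue_group \<Omega> S)"
    using left_stab_residue[OF assms t] by simp
  have "?u O t = Id_on \<Omega>" using residue.l_inv[OF tc] by simp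
  moreover have "?u O s = ?u O t O s"
    using left_stab_relcomp[OF assms t] by simp
  ultimately have "?u O s = s" using assms by (simp flip: O_assoc)
  moreover have "?u \<in> S" using residue.inv_closed[OF tc] residue_basis by simp
  ultimately show "?u \<in> left_stab s" using left_stabI assms by blast
next
  fix t u assume t: "t \<in> left_stab s" and u: "u \<in> left_stab s"
  have "t O u \<in> S"
    using t u assms by (simp add: thin_relcomp_basis left_stab_basis left_stab_valency)
  moreover have "(t O u) O s = s"
    using t u assms by (simp add: O_assoc left_stab_relcomp)
  ultimately show "t \<otimes>\<^bsub>thin_residue_group \<Omega> S\<^esub> u \<in> left_stab s"
    using left_stabI assms by simp
qed

text \<open>For a fixed pair \<open>(x, y)\<close> of \<open>s\<close>, a point \<open>z\<close>
  with \<open>(z, y)\<close> in \<open>s\<close> corresponds to the stabilizing element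
  \<open>rel x z\<close>.\<close>

lemma card_left_stab:
  assumes "s \<in> S"
  shows "card (left_stab s) = valency \<Omega> s"
proof -
  obtain x y where xy: "(x, y) \<in> s" using basis_nonempty assms by blast
  then have pts: "x \<in> \<Omega>" "y \<in> \<Omega>" using basis_points assms by blast+
  have pt: "z \<in> \<Omega>" if "(z, y) \<in> s" for z using that basis_points assms by blast
  have "bij_betw (rel x) (s\<inverse> `` {y}) (left_stab s)"
  proof (rule bij_betw_imageI)
    show "inj_on (rel x) (s\<inverse> `` {y})"
    proof (rule inj_onI)
      fix z w assume zw: "z \<in> s\<inverse> `` {y}" "w \<in> s\<inverse> `` {y}" "rel x z = rel x w"
      then have "rel x z \<in> left_stab s" using left_stab_rel assms xy by auto
      moreover have "(x, z) \<in> rel x z" "(x, w) \<in> rel x z"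
        using zw pts pt by auto
      ultimately show "z = w"
        using valency_1_unique assms left_stab_basis left_stab_valency by metis
    qed
    show "rel x ` (s\<inverse> `` {y}) = left_stab s"
    proof (intro equalityI subsetI)
      fix t assume "t \<in> rel x ` (s\<inverse> `` {y})"
      then show "t \<in> left_stab s" using left_stab_rel assms xy by auto
    next
      fix t assume t: "t \<in> left_stab s"
      then have "(x, y) \<in> t O s" using left_stab_relcomp assms xy by simp
      then obtain z where z: "(x, z) \<in> t" "(z, y) \<in> s" by blast
      then have "rel x z = t"
        using rel_eqI residue_basis left_stab_residue[OF assms t] by blast
      then show "t \<in> rel x ` (s\<inverse> `` {y})" using z by blast
    qed
  qed
  then have "card (left_stab s) = card (s\<inverse> `` {y})"
    using bij_betw_same_card by metis
  also have "\<dots> = valency \<Omega> s"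
    using card_eq_valency[of "s\<inverse>" y] assms pts valency_converse by simp
  finally show ?thesis .
qed

lemma card_left_stab_cases: "s \<in> S \<Longrightarrow> card (left_stab s) = 1 \<or> prime (card (left_stab s))"
  using card_left_stab valency_cases prime_p by metis

lemma card_left_stab_le: "s \<in> S \<Longrightarrow> card (left_stab s) \<le> p"
  using card_left_stab valency_cases prime_ge_1_nat[OF prime_p] by fastforce

lemma finite_left_stab: "finite (left_stab s)"
  using finite_scheme unfolding complex_product_def by simp

lemma left_stab_subset_stab_prod:
  assumes "r \<in> S" "s \<in> S"
  shows "left_stab r \<subseteq> stab_prod r s"
proof
  fix t assume t: "t \<in> left_stab r"
  have "Id_on \<Omega> \<in> left_stab s" using subgroup.one_closed[OF subgroup_left_stab] assms by fastforce
  moreover have "t = t O Id_on \<Omega>" using left_stab_basis[OF assms(1) t] by simp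
  ultimately show "t \<in> stab_prod r s" using t unfolding set_mult_def by auto
qed

lemma stab_prod_commute: "r \<in> S \<Longrightarrow> s \<in> S \<Longrightarrow> stab_prod r s = stab_prod s r"
  by (intro residue.set_mult_commute_subsets subgroup.subset subgroup_left_stab)

text \<open>By exchange, the line of \<open>u\<close> lies in the plane of \<open>r\<close> and
  \<open>w\<close>, which is inside that of \<open>r\<close> and \<open>s\<close>. Used in
  contrapositive form: if \<open>u\<close> is off the plane, then \<open>w\<close> is off the plane
  of \<open>r\<close> and \<open>u\<close>.\<close>

lemma stab_prod_exchange:
  assumes S: "r \<in> S" "s \<in> S" "u \<in> S" "w \<in> S"
    and "\<not> left_stab w \<subseteq> left_stab r" and w: "left_stab w \<subseteq> stab_prod r s"
    and "left_stab w \<subseteq> stab_prod r u"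
  shows "left_stab u \<subseteq> stab_prod r s"
proof
  fix t assume "t \<in> left_stab u"
  then have "t \<in> stab_prod r w"
    using residue.prime_order_exchange[OF subgroup_left_stab[OF S(1)] subgroup_left_stab[OF S(4)]
        subgroup_left_stab[OF S(3)] card_left_stab_cases[OF S(3)]] assms by blast
  then obtain a b where ab: "a \<in> left_stab r" "b \<in> left_stab w" "t = a O b"
    unfolding set_mult_def by auto
  have sub: "subgroup (stab_prod r s) (thin_residue_group \<Omega> S)"
    using residue.mult_subgroups subgroup_left_stab S by blast
  have "a \<in> stab_prod r s" "b \<in> stab_prod r s"
    using ab left_stab_subset_stab_prod[OF S(1,2)] w by blast+
  then show "t \<in> stab_prod r s" using subgroup.m_closed[OF sub] ab by fastforce
qed

text \<open>Paths for \<open>u\<close> and \<open>v\<close> can be chosen with the same middle and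
  end points; the relation between their starting points is the translating element.\<close>

lemma relcomp_translate:
  assumes S: "a \<in> S" "b \<in> S" "u \<in> S" "v \<in> S" and u: "u \<subseteq> a O b" and v: "v \<subseteq> a O b"
  shows "\<exists>t \<in> left_stab a. v = t O u"
proof -
  obtain x z where xz: "(x, z) \<in> u" using basis_nonempty S by blast
  then obtain y where y: "(x, y) \<in> a" "(y, z) \<in> b" using u by blast
  obtain x1 z1 where xz1: "(x1, z1) \<in> v" using basis_nonempty S by blast
  then obtain y1 where y1: "(x1, y1) \<in> a" "(y1, z1) \<in> b" using v by blast
  \<comment> \<open>Allows the path of \<open>v\<close> to be moved onto the edge
    \<open>(y, z)\<close> used for \<open>u\<close>.\<close>
  have "b \<subseteq> a\<inverse> O v"
    using subset_relcompI[of "a\<inverse>" v b y1 z1] S y1 xz1 by auto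
  then obtain x2 where x2: "(x2, y) \<in> a" "(x2, z) \<in> v" using y by blast
  have t: "rel x2 x \<in> left_stab a"
    using left_stab_rel S x2 y by blast
  have "rel x2 x O u = v"
    using thin_relcomp_eqI[of "rel x2 x" u v x2 x z] t S xz x2 basis_points
      left_stab_valency in_rel rel_basis by metis
  then show ?thesis using t by blast
qed

text \<open>Changes the base point from \<open>h\<close> to \<open>\<alpha>\<close>. This needs an
  argument because the stabilizers of a relation and of its converse are not identified with each
  other.\<close>

lemma left_stab_transfer:
  assumes pts: "\<alpha> \<in> \<Omega>" "g \<in> \<Omega>" "h \<in> \<Omega>" "k \<in> \<Omega>"
    and sub: "left_stab (rel h g) \<subseteq> stab_prod (rel h \<alpha>) (rel h k)"
  shows "left_stab (rel \<alpha> g) \<subseteq> stab_prod (rel \<alpha> h) (rel \<alpha> k)"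
proof
  fix t assume t: "t \<in> left_stab (rel \<alpha> g)"
  have tr: "t \<in> thin_residue S" using left_stab_residue[OF _ t] pts by simp
  then have tS: "t \<in> S" "valency \<Omega> t = 1" using residue_basis residue_thin by auto
  \<comment> \<open>The translate of \<open>\<alpha>\<close> by \<open>t\<close>; since
    \<open>t\<close> stabilizes \<open>rel \<alpha> g\<close>, both points stand in this relation to
    \<open>g\<close>.\<close>
  obtain \<alpha>2 where \<alpha>2: "(\<alpha>, \<alpha>2) \<in> t" using basis_Image_nonempty[OF tS(1)] pts by blast
  have "t\<inverse> O rel \<alpha> g = t\<inverse> O t O rel \<alpha> g"
    using left_stab_relcomp[OF _ t] pts by simp
  also have "\<dots> = rel \<alpha> g"
    using thin_converse_relcomp[OF tS] pts by (simp flip: O_assoc)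
  finally have "t\<inverse> O rel \<alpha> g = rel \<alpha> g" .
  moreover have "(\<alpha>2, g) \<in> t\<inverse> O rel \<alpha> g"
    using \<alpha>2 in_rel[OF pts(1,2)] by blast
  ultimately have "(\<alpha>2, g) \<in> rel \<alpha> g" by simp
  moreover have "rel \<alpha> g \<subseteq> rel \<alpha> h O rel h g"
    using rel_triangle pts by simp
  \<comment> \<open>\<open>h2\<close> is to \<open>\<alpha>2\<close> and \<open>g\<close> as
    \<open>h\<close> is to \<open>\<alpha>\<close> and \<open>g\<close>, so \<open>h\<close> and
    \<open>h2\<close> differ by a stabilizing element of \<open>rel h g\<close>.\<close>
  ultimately obtain h2 where h2: "(\<alpha>2, h2) \<in> rel \<alpha> h" "(h2, g) \<in> rel h g" by blast
  have h2pt: "h2 \<in> \<Omega>" using h2 basis_points pts rel_basis by blast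
  have "rel h h2 \<in> left_stab (rel h g)"
    using left_stab_rel[of "rel h g" h g h2] h2 pts by simp
  then obtain w1 w2 where w: "w1 \<in> left_stab (rel h \<alpha>)" "w2 \<in> left_stab (rel h k)" "rel h h2 = w1 O w2"
    using sub unfolding set_mult_def by auto
  have "(h, h2) \<in> w1 O w2" using w h2pt pts in_rel by metis
  \<comment> \<open>\<open>w1\<close> takes \<open>h\<close> to \<open>h3\<close> without changing
    its relation to \<open>\<alpha>\<close>; \<open>w2\<close> gives \<open>h3\<close> and
    \<open>h2\<close> the same neighbours under \<open>rel h k\<close>.\<close>
  then obtain h3 where h3: "(h, h3) \<in> w1" "(h3, h2) \<in> w2" by blast
  have h3pt: "h3 \<in> \<Omega>"
    using h3(1) basis_points left_stab_basis[OF _ w(1)] pts by auto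
  have w1: "w1 \<in> S" "valency \<Omega> w1 = 1" "w1 O rel h \<alpha> = rel h \<alpha>"
    using left_stab_basis[OF _ w(1)] left_stab_valency[OF _ w(1)] left_stab_relcomp[OF _ w(1)] pts
    by simp_all
  have "(h, \<alpha>) \<in> w1 O rel h \<alpha>" using w1 pts by simp
  then have "(h3, \<alpha>) \<in> rel h \<alpha>"
    using h3 valency_1_unique[OF w1(1,2)] by blast
  then have \<alpha>h3: "(\<alpha>, h3) \<in> rel \<alpha> h" using rel_converse pts by blast
  obtain k2 where k2: "(h2, k2) \<in> rel h k"
    using basis_Image_nonempty h2pt pts rel_basis by blast
  then have k2': "(h3, k2) \<in> rel h k"
    using left_stab_relcomp[OF _ w(2)] h3 pts by auto
  have k2pt: "k2 \<in> \<Omega>" using k2 basis_points pts rel_basis by blast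
  have \<alpha>2pt: "\<alpha>2 \<in> \<Omega>" using \<alpha>2 basis_points tS by blast
  have k: "rel \<alpha> k \<subseteq> rel \<alpha> h O rel h k"
    using rel_triangle pts by simp
  have "rel \<alpha> k2 \<subseteq> rel \<alpha> h O rel h k"
    using rel_subset_relcomp[OF _ _ \<alpha>h3 k2'] pts by simp
  then obtain a where a: "a \<in> left_stab (rel \<alpha> h)" "rel \<alpha> k2 = a O rel \<alpha> k"
    using relcomp_translate[OF _ _ _ _ k] pts k2pt by (meson rel_basis)
  have "rel \<alpha>2 k2 \<subseteq> rel \<alpha> h O rel h k"
    using rel_subset_relcomp[OF _ _ h2(1) k2] pts by simp
  then obtain a2 where a2: "a2 \<in> left_stab (rel \<alpha> h)" "rel \<alpha>2 k2 = a2 O rel \<alpha> k"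
    using relcomp_translate[OF _ _ _ _ k] pts k2pt \<alpha>2pt by (meson rel_basis)
  \<comment> \<open>Comparing \<open>\<alpha>\<close> and \<open>\<alpha>2\<close> as seen from
    \<open>k2\<close> expresses \<open>t\<close> by \<open>a\<close>, \<open>a2\<close> and an
    element \<open>b\<close> stabilizing \<open>rel \<alpha> k\<close>.\<close>
  have "t O rel \<alpha>2 k2 = rel \<alpha> k2"
    using thin_relcomp_eqI[OF tS _ _ \<alpha>2, of "rel \<alpha>2 k2" "rel \<alpha> k2" k2] pts k2pt \<alpha>2pt by simp
  then have eq: "t O a2 O rel \<alpha> k = a O rel \<alpha> k" using a a2 by simp
  let ?G = "thin_residue_group \<Omega> S"
  have car: "t \<in> carrier ?G" "a \<in> carrier ?G" "a2 \<in> carrier ?G"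
    using tr left_stab_residue[OF _ a(1)] left_stab_residue[OF _ a2(1)] pts by simp_all
  define b where "b = inv\<^bsub>?G\<^esub> a \<otimes>\<^bsub>?G\<^esub> (t \<otimes>\<^bsub>?G\<^esub> a2)"
  have bcar: "b \<in> carrier ?G" unfolding b_def using car by blast
  have "inv\<^bsub>?G\<^esub> a O a = Id_on \<Omega>" using residue.l_inv[OF car(2)] by simp
  then have "b O rel \<alpha> k = rel \<alpha> k"
    unfolding b_def using eq pts by (simp add: O_assoc) (simp flip: O_assoc)
  then have b: "b \<in> left_stab (rel \<alpha> k)"
    using left_stabI bcar residue_basis pts by simp
  have "t = (a \<otimes>\<^bsub>?G\<^esub> inv\<^bsub>?G\<^esub> a2) \<otimes>\<^bsub>?G\<^esub> b"
    unfolding b_def using car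
    by (smt (verit) residue.inv_closed residue.inv_solve_left residue.m_assoc residue.m_comm residue.m_closed)
  moreover have "a \<otimes>\<^bsub>?G\<^esub> inv\<^bsub>?G\<^esub> a2 \<in> left_stab (rel \<alpha> h)"
    using subgroup_left_stab[of "rel \<alpha> h"] a a2 pts
    by (meson rel_basis subgroup.m_closed subgroup.m_inv_closed)
  ultimately show "t \<in> stab_prod (rel \<alpha> h) (rel \<alpha> k)"
    using b unfolding set_mult_def by blast
qed

text \<open>The two paths make \<open>v\<close> a translate of \<open>rel h k\<close> by
  \<open>t\<close> in the line of \<open>rel h \<alpha>\<close> and by \<open>t2\<close> in that of
  \<open>rel h g\<close>. Their quotient stabilizes \<open>rel h k\<close>, so \<open>t2\<close>
  lies in the plane of \<open>rel h \<alpha>\<close> and \<open>rel h k\<close>, which meets the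
  line of \<open>rel h g\<close> trivially after the change of base point.\<close>

lemma desargues:
  assumes pts: "\<alpha> \<in> \<Omega>" "g \<in> \<Omega>" "h \<in> \<Omega>" "k \<in> \<Omega>"
    and indep: "\<not> left_stab (rel \<alpha> g) \<subseteq> stab_prod (rel \<alpha> h) (rel \<alpha> k)"
    and v: "v \<in> S" "v \<subseteq> rel h \<alpha> O rel \<alpha> k" "v \<subseteq> rel h g O rel g k"
  shows "v = rel h k"
proof -
  let ?G = "thin_residue_group \<Omega> S"
  have "rel h k \<subseteq> rel h x O rel x k" if "x \<in> \<Omega>" for x
    using rel_triangle pts that by simp
  then obtain t t2 where t: "t \<in> left_stab (rel h \<alpha>)" "v = t O rel h k"
    and t2: "t2 \<in> left_stab (rel h g)" "v = t2 O rel h k"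
    using relcomp_translate v pts by (metis rel_basis)
  have car: "t \<in> carrier ?G" "t2 \<in> carrier ?G"
    using left_stab_residue[OF _ t(1)] left_stab_residue[OF _ t2(1)] pts by simp_all
  define c where "c = inv\<^bsub>?G\<^esub> t \<otimes>\<^bsub>?G\<^esub> t2"
  have ccar: "c \<in> carrier ?G" unfolding c_def using car by blast
  have "inv\<^bsub>?G\<^esub> t O t = Id_on \<Omega>" using residue.l_inv[OF car(1)] by simp
  moreover have "c O rel h k = inv\<^bsub>?G\<^esub> t O t O rel h k"
    unfolding c_def using t t2 by (simp add: O_assoc)
  ultimately have "c O rel h k = rel h k" using pts by (simp flip: O_assoc)
  then have "c \<in> left_stab (rel h k)"
    using left_stabI ccar residue_basis pts by simp
  moreover have "t2 = t \<otimes>\<^bsub>?G\<^esub> c"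
    unfolding c_def using car residue.inv_solve_left by (metis ccar c_def)
  ultimately have "t2 \<in> stab_prod (rel h \<alpha>) (rel h k)"
    using t unfolding set_mult_def by blast
  moreover have "left_stab (rel h g) \<inter> stab_prod (rel h \<alpha>) (rel h k) = {\<one>\<^bsub>?G\<^esub>}"
    using residue.prime_order_Int_trivial[OF subgroup_left_stab
        residue.mult_subgroups[OF subgroup_left_stab subgroup_left_stab] card_left_stab_cases]
      left_stab_transfer[OF pts] indep pts by (meson rel_basis)
  ultimately have "t2 = Id_on \<Omega>" using t2 by auto
  then show ?thesis using t2 pts by simp
qed

text \<open>A plane containing all lines at \<open>\<alpha>\<close> would contain the whole residue
  by minimality, but it has at most \<open>p ^ 2\<close> elements.\<close>

lemma exists_outside_stab_prod:
  assumes "\<alpha> \<in> \<Omega>" "r \<in> S" "s \<in> S"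
  shows "\<exists>l \<in> \<Omega>. \<not> left_stab (rel \<alpha> l) \<subseteq> stab_prod r s"
proof (rule ccontr)
  let ?G = "thin_residue_group \<Omega> S"
  let ?A = "stab_prod r s"
  assume "\<not> ?thesis"
  then have all: "left_stab (rel \<alpha> l) \<subseteq> ?A" if "l \<in> \<Omega>" for l using that by blast
  have sub: "subgroup ?A ?G"
    using residue.mult_subgroups subgroup_left_stab assms by blast
  then have AT: "?A \<subseteq> thin_residue S" using subgroup.subset by fastforce
  have "thin_residue S \<subseteq> ?A"
  proof (rule thin_residue_least)
    show "?A \<subseteq> S" using AT thin_residue_subset by blast
    fix u assume u: "u \<in> S"
    \<comment> \<open>Every basis relation occurs as some \<open>rel \<alpha> l\<close>, so the
      assumption on points covers all of \<open>S\<close>.\<close>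
    then obtain l where l: "(\<alpha>, l) \<in> u" using basis_Image_nonempty assms by blast
    then have "rel \<alpha> l = u" "l \<in> \<Omega>" using u rel_eqI basis_points by blast+
    then show "left_stab u \<subseteq> ?A" using all by blast
  next
    fix u v assume uv: "u \<in> ?A" "v \<in> ?A"
    then have "u O v \<in> ?A" using subgroup.m_closed[OF sub] by fastforce
    moreover have "u O v \<in> S"
      using uv AT thin_residue_subset residue_thin thin_relcomp_basis by blast
    ultimately show "complex_product S u v \<subseteq> ?A"
      unfolding complex_product_def using basis_eqI basis_nonempty by (smt (verit) mem_Collect_eq subset_eq)
  qed
  then have eq: "thin_residue S = ?A" using AT by blast
  have "?A = (\<lambda>(a, b). a O b) ` (left_stab r \<times> left_stab s)"
    unfolding set_mult_def by auto
  then have "card ?A \<le> card (left_stab r) * card (left_stab s)"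
    by (metis card_cartesian_product card_image_le finite_cartesian_product finite_left_stab)
  also have "\<dots> \<le> p * p"
    using card_left_stab_le assms by (intro mult_le_mono) auto
  finally show False using card_residue eq by (simp add: power2_eq_square)
qed

end


section \<open>Algebraic isomorphisms\<close>

text \<open>Makes the valency visible to an algebraic isomorphism, which is only assumed to preserve
  intersection numbers.\<close>

lemma (in association_scheme) valency_eq_intersection_number:
  assumes "s \<in> S"
  shows "valency \<Omega> s = intersection_number s (s\<inverse>) (Id_on \<Omega>)"
proof -
  obtain x where x: "x \<in> \<Omega>" using points_nonempty by blast
  then have "card (s `` {x} \<inter> (s\<inverse>)\<inverse> `` {x}) = intersection_number s (s\<inverse>) (Id_on \<Omega>)"
    using card_eq_intersection_number[of s "s\<inverse>" "Id_on \<Omega>" x x] assms diagonal by auto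
  then show ?thesis using card_eq_valency[OF assms x] by simp
qed

locale scheme_isomorphism =
  X: association_scheme \<Omega> S + Y: association_scheme \<Omega>' S'
  for \<Omega> :: "'a set" and S and \<Omega>' :: "'b set" and S' +
  fixes \<phi> :: "'a rel \<Rightarrow> 'b rel"
  assumes algebraic: "algebraic_isomorphism S S' \<phi>"
begin

lemma image_basis [simp]: "s \<in> S \<Longrightarrow> \<phi> s \<in> S'"
  using algebraic unfolding algebraic_isomorphism_def bij_betw_def by blast

lemma image_inj: "r \<in> S \<Longrightarrow> s \<in> S \<Longrightarrow> \<phi> r = \<phi> s \<Longrightarrow> r = s"
  using algebraic unfolding algebraic_isomorphism_def bij_betw_def inj_on_def by blast

lemma image_surj: "s' \<in> S' \<Longrightarrow> \<exists>s\<in>S. \<phi> s = s'"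
  using algebraic unfolding algebraic_isomorphism_def bij_betw_def by blast

lemma image_intersection_number:
  "r \<in> S \<Longrightarrow> s \<in> S \<Longrightarrow> t \<in> S \<Longrightarrow>
    intersection_number (\<phi> r) (\<phi> s) (\<phi> t) = intersection_number r s t"
  using algebraic unfolding algebraic_isomorphism_def by simp

lemma image_subset_relcomp_iff:
  "r \<in> S \<Longrightarrow> s \<in> S \<Longrightarrow> t \<in> S \<Longrightarrow> \<phi> t \<subseteq> \<phi> r O \<phi> s \<longleftrightarrow> t \<subseteq> r O s"
  by (simp add: X.complex_product_iff Y.complex_product_iff image_intersection_number)

text \<open>Let \<open>e\<close> be the preimage of the target diagonal. Composing with
  \<open>\<phi> e\<close> changes nothing, so the diagonal of \<open>\<Omega>\<close> lies in
  \<open>e\<close> and equals it.\<close>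

lemma image_Id: "\<phi> (Id_on \<Omega>) = Id_on \<Omega>'"
proof -
  obtain e where e: "e \<in> S" "\<phi> e = Id_on \<Omega>'" using image_surj Y.diagonal by blast
  have "\<phi> (Id_on \<Omega>) \<subseteq> \<phi> (Id_on \<Omega>) O \<phi> e"
    using e X.diagonal by simp
  then have "Id_on \<Omega> \<subseteq> e"
    using image_subset_relcomp_iff[of "Id_on \<Omega>" e "Id_on \<Omega>"] e X.diagonal by simp
  moreover obtain x where "x \<in> \<Omega>" using X.points_nonempty by blast
  ultimately have "Id_on \<Omega> = e"
    using X.basis_eqI[OF X.diagonal e(1), of x x] by auto
  then show ?thesis using e by simp
qed

text \<open>The image of the diagonal yields a closed path along \<open>\<phi> s\<close> and
  \<open>\<phi> (s\<inverse>)\<close>; its way back lies in both relations to be compared.\<close>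

lemma image_converse:
  assumes "s \<in> S"
  shows "\<phi> (s\<inverse>) = (\<phi> s)\<inverse>"
proof -
  have "Id_on \<Omega> \<subseteq> s O s\<inverse>"
    using X.basis_Image_nonempty[OF assms] by fastforce
  then have "Id_on \<Omega>' \<subseteq> \<phi> s O \<phi> (s\<inverse>)"
    using image_subset_relcomp_iff[of s "s\<inverse>" "Id_on \<Omega>"] assms X.diagonal image_Id by simp
  moreover obtain x where "x \<in> \<Omega>'" using Y.points_nonempty by blast
  ultimately obtain y where "(x, y) \<in> \<phi> s" "(y, x) \<in> \<phi> (s\<inverse>)" by blast
  then show ?thesis
    using Y.basis_eqI[of "\<phi> (s\<inverse>)" "(\<phi> s)\<inverse>" y x] assms by simp
qed

lemma image_valency: "s \<in> S \<Longrightarrow> valency \<Omega>' (\<phi> s) = valency \<Omega> s"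
  using image_intersection_number[of s "s\<inverse>" "Id_on \<Omega>"] X.diagonal
  by (simp add: X.valency_eq_intersection_number Y.valency_eq_intersection_number
      image_converse image_Id)

lemma card_points_eq: "card \<Omega>' = card \<Omega>"
proof -
  have "(\<Sum>s\<in>S'. valency \<Omega>' s) = (\<Sum>s\<in>S. valency \<Omega>' (\<phi> s))"
    using algebraic sum.reindex_bij_betw[of \<phi> S S' "valency \<Omega>'"]
    unfolding algebraic_isomorphism_def by simp
  then show ?thesis
    by (simp add: image_valency X.sum_valency Y.sum_valency)
qed

text \<open>\<open>compat x x' y y'\<close>: sending \<open>x\<close> to \<open>x'\<close> and \<open>y\<close> to \<open>y'\<close> agrees with \<open>\<phi>\<close> on the pair.\<close>

abbreviation compat :: "'a \<Rightarrow> 'b \<Rightarrow> 'a \<Rightarrow> 'b \<Rightarrow> bool" where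
  "compat x x' y y' \<equiv> (x', y') \<in> \<phi> (X.rel x y)"

lemma compat_points: "x \<in> \<Omega> \<Longrightarrow> y \<in> \<Omega> \<Longrightarrow> compat x x' y y' \<Longrightarrow> x' \<in> \<Omega>' \<and> y' \<in> \<Omega>'"
  using Y.basis_points image_basis X.rel_basis by metis

lemma compat_sym: "x \<in> \<Omega> \<Longrightarrow> y \<in> \<Omega> \<Longrightarrow> compat x x' y y' \<Longrightarrow> compat y y' x x'"
  using image_converse[of "X.rel x y"] X.rel_converse[of x y] by simp

lemma rel_self: "x \<in> \<Omega> \<Longrightarrow> X.rel x x = Id_on \<Omega>"
  using X.rel_eqI X.diagonal by blast

lemma compat_self_iff: "x \<in> \<Omega> \<Longrightarrow> compat x x' x x'' \<longleftrightarrow> x' = x'' \<and> x' \<in> \<Omega>'"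
  by (auto simp: rel_self image_Id)

text \<open>\<open>\<phi>\<close> preserves inclusion in complex products, so the triangle on
  \<open>a\<close>, \<open>b\<close>, \<open>x\<close> can be copied over \<open>a'\<close>,
  \<open>b'\<close>.\<close>

lemma compat_extend:
  assumes "a \<in> \<Omega>" "b \<in> \<Omega>" "x \<in> \<Omega>" "compat a a' b b'"
  shows "\<exists>x'. compat a a' x x' \<and> compat b b' x x'"
proof -
  have "\<phi> (X.rel a b) \<subseteq> \<phi> (X.rel a x) O \<phi> (X.rel x b)"
    using X.rel_triangle assms by (simp add: image_subset_relcomp_iff)
  then obtain x' where "compat a a' x x'" "compat x x' b b'" using assms by blast
  then show ?thesis using compat_sym assms by blast
qed

text \<open>Only the diagonal is mapped to the diagonal, which gives injectivity; equal numbers of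
  points then give surjectivity.\<close>

lemma isomorphism_if_compat:
  assumes f: "\<And>x y. x \<in> \<Omega> \<Longrightarrow> y \<in> \<Omega> \<Longrightarrow> compat x (f x) y (f y)"
  shows "bij_betw f \<Omega> \<Omega>'" "r \<in> S \<Longrightarrow> map_prod f f ` r = \<phi> r"
proof -
  have mem: "f x \<in> \<Omega>'" if "x \<in> \<Omega>" for x using compat_points[OF that that f] that by simp
  have inj: "inj_on f \<Omega>"
  proof (rule inj_onI)
    fix x y assume xy: "x \<in> \<Omega>" "y \<in> \<Omega>" "f x = f y"
    then have "\<phi> (X.rel x y) = \<phi> (Id_on \<Omega>)"
      using f[OF xy(1,2)] mem Y.basis_eqI[of "\<phi> (X.rel x y)" "Id_on \<Omega>'"] Y.diagonal image_Id
      by (metis Id_onI X.rel_basis image_basis)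
    then have "X.rel x y = Id_on \<Omega>" using image_inj xy X.diagonal by simp
    then show "x = y" using X.in_rel[OF xy(1,2)] by auto
  qed
  have "f ` \<Omega> = \<Omega>'"
    using inj mem card_points_eq Y.finite_points
    by (intro card_subset_eq) (auto simp: card_image)
  then show bij: "bij_betw f \<Omega> \<Omega>'" using inj by (simp add: bij_betw_def)
  show "map_prod f f ` r = \<phi> r" if r: "r \<in> S"
  proof (intro equalityI subrelI)
    fix x' y' assume "(x', y') \<in> map_prod f f ` r"
    then obtain x y where xy: "(x, y) \<in> r" "x' = f x" "y' = f y" by auto
    then show "(x', y') \<in> \<phi> r"
      using f[of x y] X.basis_points[OF r xy(1)] X.rel_eqI[OF r xy(1)] by simp
  next
    fix x' y' assume x'y': "(x', y') \<in> \<phi> r"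
    then have "x' \<in> f ` \<Omega>" "y' \<in> f ` \<Omega>"
      using \<open>f ` \<Omega> = \<Omega>'\<close> Y.basis_points[OF image_basis[OF r] x'y'] by simp_all
    then obtain x y where xy: "x \<in> \<Omega>" "y \<in> \<Omega>" "x' = f x" "y' = f y" by blast
    then have "\<phi> (X.rel x y) = \<phi> r"
      using Y.basis_eqI[OF _ _ f x'y'[unfolded xy]] r by simp
    then have "X.rel x y = r" using image_inj xy r by simp
    then have "(x, y) \<in> r" using X.in_rel xy by blast
    then show "(x', y') \<in> map_prod f f ` r" using xy by (auto intro: rev_image_eqI)
  qed
qed

end

section \<open>Two-point extension of algebraic isomorphisms\<close>

locale abelian_residue_isomorphism =
  X: abelian_residue_scheme \<Omega> S p + scheme_isomorphism \<Omega> S \<Omega>' S' \<phi>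
  for \<Omega> :: "'a set" and S p and \<Omega>' :: "'b set" and S' \<phi>
begin

text \<open>Let \<open>\<phi> v\<close> be the relation of \<open>h'\<close> and \<open>k'\<close>.
  The paths through \<open>\<alpha>'\<close> and \<open>g'\<close> put \<open>v\<close> in two
  complex products whose only common member is \<open>rel h k\<close>.\<close>

lemma compat_desargues:
  assumes pts: "\<alpha> \<in> \<Omega>" "g \<in> \<Omega>" "h \<in> \<Omega>" "k \<in> \<Omega>"
    and compat: "compat \<alpha> \<alpha>' h h'" "compat \<alpha> \<alpha>' k k'" "compat g g' h h'" "compat g g' k k'"
    and indep: "\<not> X.left_stab (X.rel \<alpha> g) \<subseteq> X.stab_prod (X.rel \<alpha> h) (X.rel \<alpha> k)"
  shows "compat h h' k k'"
proof -
  have "h' \<in> \<Omega>'" "k' \<in> \<Omega>'" using compat_points compat pts by blast+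
  then obtain v where v: "v \<in> S" "(h', k') \<in> \<phi> v"
    using Y.ex_basis image_surj by metis
  have sub: "v \<subseteq> X.rel h x O X.rel x k"
    if x: "x \<in> \<Omega>" "compat x x' h h'" "compat x x' k k'" for x x'
  proof -
    have "(h', k') \<in> \<phi> (X.rel h x) O \<phi> (X.rel x k)"
      using compat_sym[OF x(1) pts(3) x(2)] x(3) by (rule relcompI)
    then have "\<phi> v \<subseteq> \<phi> (X.rel h x) O \<phi> (X.rel x k)"
      using Y.subset_relcompI[of _ _ "\<phi> v"] v pts x(1) by simp
    then show ?thesis using image_subset_relcomp_iff v pts x(1) by simp
  qed
  have "v = X.rel h k"
    using X.desargues[OF pts indep v(1)] sub[OF pts(1) compat(1,2)] sub[OF pts(2) compat(3,4)]
    by blast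
  then show ?thesis using v by simp
qed

text \<open>If the three lines at \<open>\<alpha>\<close> lie in a plane, an auxiliary point outside the plane reduces
  to the spatial case, as in the classical proof of the plane Desargues theorem.\<close>

lemma compat_desargues_planar:
  assumes pts: "\<alpha> \<in> \<Omega>" "g \<in> \<Omega>" "h \<in> \<Omega>" "k \<in> \<Omega>"
    and compat: "compat \<alpha> \<alpha>' g g'" "compat \<alpha> \<alpha>' h h'" "compat \<alpha> \<alpha>' k k'"
      "compat g g' h h'" "compat g g' k k'"
    and indep: "\<not> X.left_stab (X.rel \<alpha> g) \<subseteq> X.left_stab (X.rel \<alpha> h)"
      "\<not> X.left_stab (X.rel \<alpha> g) \<subseteq> X.left_stab (X.rel \<alpha> k)"
  shows "compat h h' k k'"
proof (cases "X.left_stab (X.rel \<alpha> g) \<subseteq> X.stab_prod (X.rel \<alpha> h) (X.rel \<alpha> k)")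
  case False
  then show ?thesis using compat_desargues[OF pts compat(2-5)] by blast
next
  case True
  have rels: "X.rel \<alpha> h \<in> S" "X.rel \<alpha> k \<in> S" "X.rel \<alpha> g \<in> S" using pts by simp_all
  have comm: "X.stab_prod (X.rel \<alpha> h) (X.rel \<alpha> k) = X.stab_prod (X.rel \<alpha> k) (X.rel \<alpha> h)"
    using rels(1,2) by (rule X.stab_prod_commute)
  obtain l where l: "l \<in> \<Omega>"
      "\<not> X.left_stab (X.rel \<alpha> l) \<subseteq> X.stab_prod (X.rel \<alpha> h) (X.rel \<alpha> k)"
    using X.exists_outside_stab_prod[OF pts(1) rels(1,2)] by blast
  have lS: "X.rel \<alpha> l \<in> S" using pts(1) l(1) by simp
  obtain l' where l': "compat \<alpha> \<alpha>' l l'" "compat g g' l l'"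
    using compat_extend[OF pts(1,2) l(1) compat(1)] by blast
  \<comment> \<open>By exchange: the plane of \<open>h\<close> and \<open>k\<close> contains the
    line of \<open>g\<close> but not that of \<open>l\<close>.\<close>
  have "\<not> X.left_stab (X.rel \<alpha> g) \<subseteq> X.stab_prod (X.rel \<alpha> h) (X.rel \<alpha> l)"
    using X.stab_prod_exchange[OF rels(1,2) lS rels(3) indep(1) True] l(2) by blast
  then have hl: "compat h h' l l'"
    using compat_desargues[OF pts(1-3) l(1) compat(2) l'(1) compat(4) l'(2)] by blast
  have "\<not> X.left_stab (X.rel \<alpha> g) \<subseteq> X.stab_prod (X.rel \<alpha> k) (X.rel \<alpha> l)"
    using X.stab_prod_exchange[OF rels(2,1) lS rels(3) indep(2) True[unfolded comm]]
      l(2)[unfolded comm] by blast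
  then have kl: "compat k k' l l'"
    using compat_desargues[OF pts(1,2,4) l(1) compat(3) l'(1) compat(5) l'(2)] by blast
  \<comment> \<open>Now tied to both \<open>h\<close> and \<open>k\<close>, the point
    \<open>l\<close> replaces \<open>g\<close> as pivot.\<close>
  show ?thesis
    using compat_desargues[OF pts(1) l(1) pts(3,4) compat(2,3) _ _ l(2)]
      compat_sym[OF pts(3) l(1) hl] compat_sym[OF pts(4) l(1) kl] by blast
qed

text \<open>Pairs are checked according to whether none, one or both of the two points have the same
  line at \<open>\<alpha>\<close> as \<open>g\<close>.\<close>

lemma extend_nonthin_pair:
  assumes \<alpha>: "\<alpha> \<in> \<Omega>" and g: "g \<in> \<Omega>" and nonthin: "valency \<Omega> (X.rel \<alpha> g) = p"
    and \<alpha>g: "compat \<alpha> \<alpha>' g g'"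
  shows "\<exists>f. (\<forall>x\<in>\<Omega>. \<forall>y\<in>\<Omega>. compat x (f x) y (f y)) \<and> f \<alpha> = \<alpha>' \<and> f g = g'"
proof -
  define L where "L x = X.left_stab (X.rel \<alpha> x)" for x
  define P where "P x y = X.stab_prod (X.rel \<alpha> x) (X.rel \<alpha> y)" for x y
  have ex_outside: "\<exists>l\<in>\<Omega>. \<not> L l \<subseteq> P x y" if "x \<in> \<Omega>" "y \<in> \<Omega>" for x y
    unfolding L_def P_def using X.exists_outside_stab_prod[OF \<alpha>] that \<alpha> by simp
  have L_subset_P: "L x \<subseteq> P x y" if "x \<in> \<Omega>" "y \<in> \<Omega>" for x y
    unfolding L_def P_def using X.left_stab_subset_stab_prod that \<alpha> by simp
  have desargues: "compat x x' y y'"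
    if "l \<in> \<Omega>" "x \<in> \<Omega>" "y \<in> \<Omega>" "compat \<alpha> \<alpha>' x x'" "compat \<alpha> \<alpha>' y y'"
      "compat l l' x x'" "compat l l' y y'" "\<not> L l \<subseteq> P x y" for l l' x x' y y'
    using compat_desargues[OF \<alpha> that(1-7)] that(8) unfolding L_def P_def by simp
  \<comment> \<open>\<open>L g\<close> has the largest possible order \<open>p\<close>, so no other
    line contains it.\<close>
  have not_subset: "\<not> L g \<subseteq> L x" if "x \<in> \<Omega>" "L x \<noteq> L g" for x
  proof
    assume "L g \<subseteq> L x"
    moreover have "card (L x) \<le> p" "card (L g) = p" "finite (L x)"
      unfolding L_def using X.card_left_stab_le X.card_left_stab X.finite_left_stab nonthin that \<alpha> g
      by simp_all
    ultimately show False using that card_seteq by metis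
  qed

  have "\<forall>x\<in>\<Omega>. \<exists>x'. compat \<alpha> \<alpha>' x x' \<and> compat g g' x x'"
    using compat_extend \<alpha> g \<alpha>g by blast
  then obtain f1 where f1: "\<And>x. x \<in> \<Omega> \<Longrightarrow> compat \<alpha> \<alpha>' x (f1 x)" "\<And>x. x \<in> \<Omega> \<Longrightarrow> compat g g' x (f1 x)"
    by metis
  have stage1: "compat x (f1 x) y (f1 y)"
    if xy: "x \<in> \<Omega>" "y \<in> \<Omega>" "L x \<noteq> L g" "L y \<noteq> L g" for x y
    using compat_desargues_planar[OF \<alpha> g xy(1,2) \<alpha>g f1(1)[OF xy(1)] f1(1)[OF xy(2)]
        f1(2)[OF xy(1)] f1(2)[OF xy(2)]] not_subset xy unfolding L_def by blast

  \<comment> \<open>\<open>P g g\<close> is the degenerate plane \<open>L g\<close>; in this form it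
    matches \<open>P x y\<close> for two points on that line.\<close>
  obtain h where h: "h \<in> \<Omega>" "\<not> L h \<subseteq> P g g" using ex_outside g by blast
  then have hg: "\<not> L h \<subseteq> L g" using L_subset_P g by blast
  have "\<forall>x\<in>\<Omega>. \<exists>x'. compat \<alpha> \<alpha>' x x' \<and> compat h (f1 h) x x'"
    using compat_extend[OF \<alpha> h(1) _ f1(1)[OF h(1)]] by blast
  then obtain f2 where f2: "\<And>x. x \<in> \<Omega> \<Longrightarrow> compat \<alpha> \<alpha>' x (f2 x)"
      "\<And>x. x \<in> \<Omega> \<Longrightarrow> compat h (f1 h) x (f2 x)"
    by metis

  \<comment> \<open>The pivot \<open>g\<close> gives no control over points on its own line; these are placed by means of \<open>h\<close>.\<close>
  define f where "f x = (if L x \<noteq> L g \<or> x = g then f1 x else f2 x)" for x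
  have f_eq: "f x = f1 x" if "L x \<noteq> L g" for x using that by (simp add: f_def)
  \<comment> \<open>The relation of \<open>g\<close> to itself is the diagonal, so \<open>f1\<close>
    has the prescribed value at \<open>g\<close>; hence the exception \<open>x = g\<close> in
    \<open>f\<close>.\<close>
  have f1g: "f1 g = g'" using f1(2)[OF g] compat_self_iff[OF g] by simp
  then have fg: "f g = g'" by (simp add: f_def)
  have f\<alpha>: "compat \<alpha> \<alpha>' x (f x)" if "x \<in> \<Omega>" for x
    using f1 f2 that by (simp add: f_def)
  have fh: "compat h (f h) x (f x)" if "x \<in> \<Omega>" "L x = L g" for x
  proof (cases "x = g")
    case True
    then show ?thesis using compat_sym[OF g h(1) f1(2)[OF h(1)]] f_eq[of h] hg fg by auto
  next
    case False
    then show ?thesis using f2(2) that f_eq[of h] hg by (auto simp: f_def)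
  qed
  have stage1': "compat x (f x) y (f y)"
    if "x \<in> \<Omega>" "y \<in> \<Omega>" "L x \<noteq> L g" "L y \<noteq> L g" for x y
    using stage1 f_eq that by simp
  have hg': "L h \<noteq> L g" using hg by blast
  \<comment> \<open>If \<open>h\<close> is outside the plane of \<open>x\<close> and
    \<open>y\<close>, it is the pivot. Otherwise a point \<open>l\<close> outside the plane is tied
    to \<open>x\<close> through \<open>h\<close> and to \<open>y\<close> by the first stage, and
    then serves as pivot.\<close>
  have stage2: "compat x (f x) y (f y)"
    if x: "x \<in> \<Omega>" "L x = L g" and y: "y \<in> \<Omega>" "L y \<noteq> L g" for x y
  proof (cases "L h \<subseteq> P x y")
    case False
    then show ?thesis
      using desargues[OF h(1) x(1) y(1) f\<alpha>[OF x(1)] f\<alpha>[OF y(1)] fh[OF x]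
          stage1'[OF h(1) y(1) hg' y(2)]] by blast
  next
    case True
    obtain l where l: "l \<in> \<Omega>" "\<not> L l \<subseteq> P x y" using ex_outside x y by blast
    then have lg: "L l \<noteq> L g" using L_subset_P x y by metis
    have "\<not> L h \<subseteq> P x l"
      using X.stab_prod_exchange[of "X.rel \<alpha> x" "X.rel \<alpha> y" "X.rel \<alpha> l" "X.rel \<alpha> h"]
        X.rel_basis[OF \<alpha>] True hg x y l h(1) unfolding L_def P_def by blast
    then have "compat x (f x) l (f l)"
      using desargues[OF h(1) x(1) l(1) f\<alpha>[OF x(1)] f\<alpha>[OF l(1)] fh[OF x]
          stage1'[OF h(1) l(1) hg' lg]] by blast
    then have "compat l (f l) x (f x)" using compat_sym x l by blast
    then show ?thesis
      using desargues[OF l(1) x(1) y(1) f\<alpha>[OF x(1)] f\<alpha>[OF y(1)] _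
          stage1'[OF l(1) y(1) lg y(2)] l(2)] by blast
  qed
  \<comment> \<open>The plane of \<open>x\<close> and \<open>y\<close> is \<open>P g g\<close>,
    which does not contain \<open>L h\<close> by choice of \<open>h\<close>.\<close>
  have stage3: "compat x (f x) y (f y)"
    if x: "x \<in> \<Omega>" "L x = L g" and y: "y \<in> \<Omega>" "L y = L g" for x y
  proof -
    have "P x y = P g g" using x y unfolding L_def P_def by simp
    then show ?thesis
      using desargues[OF h(1) x(1) y(1) f\<alpha>[OF x(1)] f\<alpha>[OF y(1)] fh[OF x] fh[OF y]] h(2) by simp
  qed
  have "compat x (f x) y (f y)" if "x \<in> \<Omega>" "y \<in> \<Omega>" for x y
    using stage1' stage2 stage3 compat_sym that by metis
  moreover have "f \<alpha> = \<alpha>'" using f\<alpha>[OF \<alpha>] compat_self_iff[OF \<alpha>] by simp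
  ultimately show ?thesis using fg by blast
qed

text \<open>For a thin pair, a nonthin pair at \<open>\<alpha>\<close> is extended instead; the
  image of \<open>\<beta>\<close> is then forced by valency 1.\<close>

lemma extend_pair:
  assumes \<alpha>: "\<alpha> \<in> \<Omega>" and \<beta>: "\<beta> \<in> \<Omega>" and \<alpha>\<beta>: "compat \<alpha> \<alpha>' \<beta> \<beta>'"
  shows "\<exists>f. bij_betw f \<Omega> \<Omega>' \<and> (\<forall>r\<in>S. map_prod f f ` r = \<phi> r) \<and> f \<alpha> = \<alpha>' \<and> f \<beta> = \<beta>'"
proof -
  have "\<exists>f. (\<forall>x\<in>\<Omega>. \<forall>y\<in>\<Omega>. compat x (f x) y (f y)) \<and> f \<alpha> = \<alpha>' \<and> f \<beta> = \<beta>'"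
  proof (cases "valency \<Omega> (X.rel \<alpha> \<beta>) = p")
    case True
    then show ?thesis using extend_nonthin_pair assms by blast
  next
    case False
    then have thin: "valency \<Omega>' (\<phi> (X.rel \<alpha> \<beta>)) = 1"
      using X.valency_cases \<alpha> \<beta> image_valency by (metis X.rel_basis)
    obtain s where s: "s \<in> S" "valency \<Omega> s = p" using X.valencies by (metis imageE insertCI)
    obtain g where g: "(\<alpha>, g) \<in> s" using X.basis_Image_nonempty s \<alpha> by blast
    have gpt: "g \<in> \<Omega>" "X.rel \<alpha> g = s" using g s X.basis_points X.rel_eqI by blast+
    have "\<alpha>' \<in> \<Omega>'" using compat_points[OF \<alpha> \<beta> \<alpha>\<beta>] by simp
    then obtain g' where "(\<alpha>', g') \<in> \<phi> s" using Y.basis_Image_nonempty s image_basis by metis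
    then obtain f where f: "\<forall>x\<in>\<Omega>. \<forall>y\<in>\<Omega>. compat x (f x) y (f y)" "f \<alpha> = \<alpha>'"
      using extend_nonthin_pair[OF \<alpha> gpt(1)] gpt s by metis
    then have "compat \<alpha> \<alpha>' \<beta> (f \<beta>)" using \<alpha> \<beta> by metis
    then have "f \<beta> = \<beta>'"
      using Y.valency_1_unique[OF _ thin _ \<alpha>\<beta>] \<alpha> \<beta> by simp
    then show ?thesis using f by blast
  qed
  then show ?thesis using isomorphism_if_compat by metis
qed

end

section \<open>Separability and schurity\<close>

context abelian_residue_scheme
begin

lemma separable: "separable TYPE('b) \<Omega> S"
  unfolding separable_def
proof (intro allI impI)
  fix \<Omega>' :: "'b set" and S' \<phi>
  assume *: "association_scheme \<Omega>' S' \<and> algebraic_isomorphism S S' \<phi>"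
  interpret Y: association_scheme \<Omega>' S' using * by blast
  interpret abelian_residue_isomorphism \<Omega> S p \<Omega>' S' \<phi>
    by unfold_locales (use * in blast)
  \<comment> \<open>With no pair prescribed, the extension is applied to the degenerate pair
    \<open>\<alpha>\<close>, \<open>\<alpha>\<close>.\<close>
  obtain \<alpha> \<alpha>' where "\<alpha> \<in> \<Omega>" "\<alpha>' \<in> \<Omega>'" using points_nonempty Y.points_nonempty by blast
  then have "\<exists>f. bij_betw f \<Omega> \<Omega>' \<and> (\<forall>r\<in>S. map_prod f f ` r = \<phi> r) \<and> f \<alpha> = \<alpha>' \<and> f \<alpha> = \<alpha>'"
    by (intro extend_pair) (auto simp: compat_self_iff)
  then show "\<exists>f. bij_betw f \<Omega> \<Omega>' \<and> (\<forall>r\<in>S. map_prod f f ` r = \<phi> r)" by blast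
qed

definition automorphisms :: "('a \<Rightarrow> 'a) set" where
  "automorphisms = {f \<in> Bij \<Omega>. \<forall>x\<in>\<Omega>. \<forall>y\<in>\<Omega>. rel (f x) (f y) = rel x y}"

lemma Bij_apply: "f \<in> Bij \<Omega> \<Longrightarrow> x \<in> \<Omega> \<Longrightarrow> f x \<in> \<Omega>"
  using Bij_imp_funcset by blast

lemma subgroup_automorphisms: "subgroup automorphisms (BijGroup \<Omega>)"
proof (rule group.subgroupI[OF group_BijGroup])
  show "automorphisms \<subseteq> carrier (BijGroup \<Omega>)"
    by (auto simp: automorphisms_def BijGroup_def)
  have "(\<lambda>x\<in>\<Omega>. x) \<in> automorphisms"
    by (simp add: automorphisms_def id_Bij)
  then show "automorphisms \<noteq> {}" by blast
next
  fix f assume f: "f \<in> automorphisms"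
  then have fB: "f \<in> Bij \<Omega>" by (simp add: automorphisms_def)
  have inv: "inv_into \<Omega> f x \<in> \<Omega>" "f (inv_into \<Omega> f x) = x" if "x \<in> \<Omega>" for x
    using fB that Bij_inv_into_mem[OF fB] by (auto simp: Bij_def bij_betw_def f_inv_into_f)
  have "rel (inv_into \<Omega> f x) (inv_into \<Omega> f y) = rel x y" if "x \<in> \<Omega>" "y \<in> \<Omega>" for x y
    using f inv[OF that(1)] inv[OF that(2)] by (force simp: automorphisms_def)
  then show "inv\<^bsub>BijGroup \<Omega>\<^esub> f \<in> automorphisms"
    using restrict_inv_into_Bij[OF fB] by (simp add: inv_BijGroup[OF fB] automorphisms_def)
next
  fix f g assume "f \<in> automorphisms" "g \<in> automorphisms"
  then show "f \<otimes>\<^bsub>BijGroup \<Omega>\<^esub> g \<in> automorphisms"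
    by (auto simp: automorphisms_def BijGroup_def compose_Bij compose_eq Bij_apply)
qed

lemma automorphism_moving_pair:
  assumes "s \<in> S" "(x, y) \<in> s" "(x', y') \<in> s"
  shows "\<exists>f \<in> automorphisms. f x = x' \<and> f y = y'"
proof -
  interpret abelian_residue_isomorphism \<Omega> S p \<Omega> S "\<lambda>s. s"
    by unfold_locales (simp add: algebraic_isomorphism_def bij_betw_def)
  have xy: "x \<in> \<Omega>" "y \<in> \<Omega>" using assms basis_points by blast+
  then obtain f where f: "bij_betw f \<Omega> \<Omega>" "\<forall>r\<in>S. map_prod f f ` r = r" "f x = x'" "f y = y'"
    using extend_pair[of x y x' y'] assms rel_eqI by blast
  have "rel (f u) (f v) = rel u v" if "u \<in> \<Omega>" "v \<in> \<Omega>" for u v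
  proof (rule rel_eqI)
    have "map_prod f f (u, v) \<in> map_prod f f ` rel u v"
      using that by (intro imageI) simp
    then show "(f u, f v) \<in> rel u v" using f(2) that by simp
  qed (use that in simp)
  then have "restrict f \<Omega> \<in> automorphisms"
    using f(1) by (simp add: automorphisms_def Bij_def)
  then show ?thesis using f xy by (intro bexI[of _ "restrict f \<Omega>"]) auto
qed

text \<open>Automorphisms keep each orbit of pairs inside a basis relation, and two-point extension
  makes it fill the relation; the diagonal gives transitivity.\<close>

lemma schurian: "schurian \<Omega> S"
  unfolding schurian_def
proof (intro exI conjI)
  let ?K = "(BijGroup \<Omega>)\<lparr>carrier := automorphisms\<rparr>"
  show "subgroup automorphisms (BijGroup \<Omega>)" by (rule subgroup_automorphisms)
  interpret B: group "BijGroup \<Omega>" by (rule group_BijGroup)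
  have "group ?K" using subgroup_automorphisms by (rule B.subgroup_imp_group)
  moreover have "(\<lambda>g. g) \<in> hom ?K (BijGroup \<Omega>)"
    using subgroup.subset[OF subgroup_automorphisms] by (auto simp: hom_def)
  ultimately have action: "group_action ?K \<Omega> (\<lambda>g. g)"
    by (simp add: group_action_def group_hom_def group_hom_axioms_def group_BijGroup)
  show "transitive_action ?K \<Omega> (\<lambda>g. g)"
  proof (intro transitive_action.intro transitive_action_axioms.intro action)
    fix x y assume "x \<in> \<Omega>" "y \<in> \<Omega>"
    then show "\<exists>g\<in>carrier ?K. g x = y"
      using automorphism_moving_pair[OF diagonal, of x x y y] by auto
  qed
  have orbit: "orbit ?K (\<lambda>g. map_prod g g) (x, y) = rel x y" if xy: "x \<in> \<Omega>" "y \<in> \<Omega>" for x y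
  proof (intro equalityI subrelI)
    fix u v assume "(u, v) \<in> orbit ?K (\<lambda>g. map_prod g g) (x, y)"
    then obtain g where g: "g \<in> automorphisms" "u = g x" "v = g y"
      by (auto simp: orbit_def)
    then have "g x \<in> \<Omega>" "g y \<in> \<Omega>" using xy by (simp_all add: automorphisms_def Bij_apply)
    then have "(u, v) \<in> rel (g x) (g y)" using g by simp
    then show "(u, v) \<in> rel x y" using g xy by (simp add: automorphisms_def)
  next
    fix u v assume "(u, v) \<in> rel x y"
    then show "(u, v) \<in> orbit ?K (\<lambda>g. map_prod g g) (x, y)"
      using automorphism_moving_pair[of "rel x y" x y u v] xy by (force simp: orbit_def)
  qed
  have "orbits ?K (\<Omega> \<times> \<Omega>) (\<lambda>g. map_prod g g) = {rel x y | x y. x \<in> \<Omega> \<and> y \<in> \<Omega>}"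
    unfolding orbits_def using orbit by force
  also have "\<dots> = S"
  proof (intro equalityI subsetI)
    fix s assume s: "s \<in> S"
    then obtain x y where "(x, y) \<in> s" using basis_nonempty by blast
    then show "s \<in> {rel x y | x y. x \<in> \<Omega> \<and> y \<in> \<Omega>}"
      using s rel_eqI basis_points by blast
  qed auto
  finally show "orbits ?K (\<Omega> \<times> \<Omega>) (\<lambda>g. map_prod g g) = S" .
qed

end

section \<open>Elementary abelian groups\<close>

text \<open>As \<open>G\<close> is only known to be a monoid, \<open>h \<one>\<close> is shown
  neutral by being idempotent in a group, and inverses are taken as preimages of inverses.\<close>

lemma (in monoid) comm_group_if_iso:
  assumes H: "comm_group H" and iso: "G \<cong> H"
  shows "comm_group G"
proof -
  interpret H: comm_group H by (rule H)
  obtain h where h: "h \<in> hom G H" "bij_betw h (carrier G) (carrier H)"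
    using iso by (auto simp: is_iso_def iso_def)
  have mem: "h x \<in> carrier H" if "x \<in> carrier G" for x
    using h(1) that by (rule hom_in_carrier)
  have inj: "x = y" if "h x = h y" "x \<in> carrier G" "y \<in> carrier G" for x y
    using h(2) that by (auto simp: bij_betw_def inj_on_def)
  have "h \<one> \<otimes>\<^bsub>H\<^esub> h \<one> = h \<one>" using hom_mult[OF h(1)] by (metis l_one one_closed)
  then have h1: "h \<one> = \<one>\<^bsub>H\<^esub>" using mem by simp
  show ?thesis
  proof (rule comm_groupI)
    fix x y assume "x \<in> carrier G" "y \<in> carrier G"
    then show "x \<otimes> y = y \<otimes> x"
      using hom_mult[OF h(1)] H.m_comm mem by (intro inj) auto
  next
    fix x assume x: "x \<in> carrier G"
    then have "inv\<^bsub>H\<^esub> h x \<in> h ` carrier G"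
      using h(2) mem by (simp add: bij_betw_def)
    then obtain y where y: "y \<in> carrier G" "h y = inv\<^bsub>H\<^esub> h x" by force
    then have "y \<otimes> x = \<one>"
      using hom_mult[OF h(1) y(1) x] h1 mem x by (intro inj) auto
    then show "\<exists>y\<in>carrier G. y \<otimes> x = \<one>" using y by blast
  qed (auto simp: m_assoc)
qed

lemma comm_group_elementary_abelian: "comm_group (elementary_abelian p m)"
proof -
  interpret group "elementary_abelian p m"
    unfolding elementary_abelian_def by simp
  show ?thesis
    by (rule group_comm_groupI)
      (auto simp: elementary_abelian_def product_group_def add.commute intro!: restrict_ext)
qed

lemma card_elementary_abelian: "p > 0 \<Longrightarrow> card (carrier (elementary_abelian p m)) = p ^ m"
  by (simp add: elementary_abelian_def carrier_product_group card_PiE carrier_integer_mod_group)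

theorem theorem1p4:
  fixes p m :: nat and \<Omega> :: "'a set" and S :: "'a rel set"
  assumes "prime p"
    and "one_p_scheme p \<Omega> S"
    and "\<forall>s \<in> thin_residue S. thin \<Omega> s"
    and "thin_residue_group \<Omega> S \<cong> elementary_abelian p m"
    and "m > 2"
  shows "schurian \<Omega> S \<and> separable TYPE('b) \<Omega> S"
proof -
  interpret association_scheme \<Omega> S using assms(2) by (simp add: one_p_scheme_def)
  have thin: "\<forall>s \<in> thin_residue S. valency \<Omega> s = 1"
    using assms(3) by (simp add: thin_def)
  obtain h where h: "h \<in> iso (thin_residue_group \<Omega> S) (elementary_abelian p m)"
    using assms(4) by (auto simp: is_iso_def)
  have "card (thin_residue S) = p ^ m"
    using bij_betw_same_card[of h "thin_residue S"] h
      card_elementary_abelian[OF prime_gt_0_nat[OF assms(1)]]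
    by (auto simp: iso_def)
  \<comment> \<open>The rank condition enters here, as the statement that two lines cannot span the
    residue.\<close>
  then have card: "p ^ 2 < card (thin_residue S)"
    using assms(1,5) prime_gt_1_nat by simp
  have "comm_group (thin_residue_group \<Omega> S)"
    using monoid_thin_residue_group[OF thin] comm_group_elementary_abelian assms(4)
    by (rule monoid.comm_group_if_iso)
  then interpret abelian_residue_scheme \<Omega> S p
    using assms(1,2) thin card
    by (intro abelian_residue_scheme.intro abelian_residue_scheme_axioms.intro association_scheme_axioms)
      (simp_all add: one_p_scheme_def)
  show ?thesis using schurian separable by blast
qed


end
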